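(* Let $C_n$ denote the cycle of order $n$ ($n\geq 3$). Then: (a) $pvc(C_3)=0$, $pvc(C_4)=pvc(C_5)=1$, and $pvc(C_n)=2$ for all $n\geq 6$. (b) $pvc_2(C_3)=1$, $pvc_2(C_n)=2$ for all even $n\geq 4$, and $pvc_2(C_n)=3$ for all odd $n\geq 5$.
   Context: All graphs are simple, finite and undirected. Vertex-colorings are arbitrary (adjacent vertices may receive the same color). A path in a vertex-colored graph is a vertex-proper path if any two adjacent internal vertices of the path differ in color (the end-vertices of the path are not internal). A set of internally vertex-disjoint paths is called disjoint. A vertex-colored graph is proper vertex $k$-connected if any two distinct vertices are connected by $k$ (distinct) disjoint vertex-proper paths. For a $k$-connected graph $G$, $pvc_k(G)$ is the smallest number of colors required to make $G$ proper vertex $k$-connected; $pvc(G)=pvc_1(G)$. The value $0$ is allowed: it means that no vertex needs to be colored, where an uncolored path counts as vertex-proper exactly when it has no internal vertices. *)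

theory Defs
  imports "Graph_Theory.Graph_Theory"
begin

text \<open>
  A finite simple undirected graph is a \<open>pair_graph\<close>: a finite, loop-free symmetric digraph
  without parallel arcs, so that every edge is represented by its two orientations.
  A path is a \<open>vpath\<close>, that is, a nonempty list of pairwise distinct vertices, consecutive
  ones being adjacent.
\<close>

definition cycle_graph :: "nat \<Rightarrow> nat pair_pre_digraph" where
  "cycle_graph n =
     \<lparr> pverts = {..<n},
       parcs = {(i, j). i < n \<and> j < n \<and> (j = Suc i mod n \<or> i = Suc j mod n)} \<rparr>"

lemma pair_graph_cycle_graph:
  assumes "n \<ge> 3"
  shows "pair_graph (cycle_graph n)"
proof unfold_locales
  show "finite (parcs (cycle_graph n))"
    by (rule finite_subset[of _ "{..<n} \<times> {..<n}"]) (auto simp: cycle_graph_def)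
  show "symmetric (with_proj (cycle_graph n))"
    by (auto simp: symmetric_def cycle_graph_def intro: symI)
  show "fst e \<noteq> snd e" if "e \<in> parcs (cycle_graph n)" for e
    using that assms by (auto simp: cycle_graph_def mod_Suc split: if_splits)
qed (auto simp: cycle_graph_def)

definition internal :: "'a list \<Rightarrow> 'a list" where
  "internal p = butlast (tl p)"

definition paths_between :: "'a pair_pre_digraph \<Rightarrow> 'a \<Rightarrow> 'a \<Rightarrow> 'a list set" where
  "paths_between G u v = {p. vpath p (with_proj G) \<and> hd p = u \<and> last p = v}"

definition disjoint_paths :: "'a list set \<Rightarrow> bool" where
  "disjoint_paths P \<longleftrightarrow> pairwise (\<lambda>p q. set (internal p) \<inter> set (internal q) = {}) P"

text \<open>
  A vertex-coloring assigns to each vertex a color \<open>Some i\<close>; the only other possibility is that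
  no vertex is colored at all (every vertex is sent to \<open>None\<close>). The latter is what
  makes zero colors possible on a nonempty graph.
\<close>

definition vertex_coloring :: "'a pair_pre_digraph \<Rightarrow> ('a \<Rightarrow> nat option) \<Rightarrow> bool" where
  "vertex_coloring G c \<longleftrightarrow>
     (\<forall>v\<in>pverts G. c v \<noteq> None) \<or> (\<forall>v\<in>pverts G. c v = None)"

definition num_colors :: "'a pair_pre_digraph \<Rightarrow> ('a \<Rightarrow> nat option) \<Rightarrow> nat" where
  "num_colors G c = card {i. \<exists>v\<in>pverts G. c v = Some i}"

text \<open>
  Requiring internal vertices to be colored only matters for uncolored graphs: there, exactly
  the paths without internal vertices are vertex-proper.
\<close>

definition vertex_proper_path :: "('a \<Rightarrow> nat option) \<Rightarrow> 'a list \<Rightarrow> bool" where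
  "vertex_proper_path c p \<longleftrightarrow>
     (\<forall>x\<in>set (internal p). c x \<noteq> None) \<and> successively (\<lambda>x y. c x \<noteq> c y) (internal p)"

definition proper_vertex_connected ::
    "nat \<Rightarrow> 'a pair_pre_digraph \<Rightarrow> ('a \<Rightarrow> nat option) \<Rightarrow> bool" where
  "proper_vertex_connected k G c \<longleftrightarrow>
     (\<forall>u\<in>pverts G. \<forall>v\<in>pverts G. u \<noteq> v \<longrightarrow>
        (\<exists>P \<subseteq> paths_between G u v.
           finite P \<and> card P = k \<and> disjoint_paths P \<and> (\<forall>p\<in>P. vertex_proper_path c p)))"

text \<open>
  Only meaningful for \<open>k\<close>-connected graphs, where some coloring (for instance one
  with pairwise distinct colors) qualifies; otherwise the value is unspecified.
\<close>

definition pvc_k :: "nat \<Rightarrow> 'a pair_pre_digraph \<Rightarrow> nat" where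
  "pvc_k k G =
     (LEAST m. \<exists>c. vertex_coloring G c \<and> num_colors G c = m \<and> proper_vertex_connected k G c)"

abbreviation pvc :: "'a pair_pre_digraph \<Rightarrow> nat" where
  "pvc \<equiv> pvc_k 1"

end

theory Submission
  imports Defs
begin

text \<open>
  Monochromatic vertex-proper paths have at most one internal vertex, which settles the small
  cases and excludes one color for \<open>n \<ge> 6\<close>. Alternating two colors along \<open>0, \<dots>, n - 1\<close> makes
  every path that avoids the edge between \<open>n - 1\<close> and \<open>0\<close> vertex-proper, and every pair of
  vertices is joined by such a path. Two disjoint paths between adjacent vertices must be the
  edge itself and the path all the way around; varying the edge shows that a proper vertex
  2-connected cycle with \<open>n \<ge> 4\<close> is properly colored in the usual sense, so that part (b)
  reduces to the chromatic number of a cycle.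
\<close>

section \<open>Edges of the cycle and reversal of paths\<close>

lemma pverts_cycle_graph [simp]: "pverts (cycle_graph n) = {..<n}"
  by (simp add: cycle_graph_def)

text \<open>This form singles out the wraparound edge and suits linear arithmetic; the modular form
  below suits arguments that rotate along the cycle.\<close>

lemma parcs_cycle_graph_iff:
  "(i, j) \<in> parcs (cycle_graph n) \<longleftrightarrow>
     i < n \<and> j < n \<and> (j = Suc i \<or> i = Suc j \<or> i = 0 \<and> j = n - 1 \<or> i = n - 1 \<and> j = 0)"
  by (auto simp: cycle_graph_def mod_Suc)

lemma parcs_cycle_graph_mod_iff:
  "(i, j) \<in> parcs (cycle_graph n) \<longleftrightarrow> i < n \<and> j < n \<and> (j = Suc i mod n \<or> i = Suc j mod n)"
  by (simp add: cycle_graph_def)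

lemma parcs_cycle_graph_sym:
  "(i, j) \<in> parcs (cycle_graph n) \<longleftrightarrow> (j, i) \<in> parcs (cycle_graph n)"
  by (auto simp: cycle_graph_def)

lemma set_vwalk_arcs_subset_iff:
  "set (vwalk_arcs p) \<subseteq> A \<longleftrightarrow> successively (\<lambda>x y. (x, y) \<in> A) p"
  by (induction p rule: vwalk_arcs.induct) auto

lemma paths_between_iff:
  "p \<in> paths_between G u v \<longleftrightarrow>
     p \<noteq> [] \<and> distinct p \<and> set p \<subseteq> pverts G \<and> successively (\<lambda>x y. (x, y) \<in> parcs G) p \<and>
     hd p = u \<and> last p = v"
  by (auto simp: paths_between_def vpath_def vwalk_def set_vwalk_arcs_subset_iff)

lemma internal_rev: "internal (rev p) = rev (internal p)"
  unfolding internal_def by (metis butlast_rev butlast_tl rev_swap)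

lemma vertex_proper_path_rev: "vertex_proper_path c (rev p) \<longleftrightarrow> vertex_proper_path c p"
  by (simp add: vertex_proper_path_def internal_rev eq_commute)

lemma rev_mem_paths_between_cycle_graph:
  "p \<in> paths_between (cycle_graph n) u v \<Longrightarrow> rev p \<in> paths_between (cycle_graph n) v u"
  using parcs_cycle_graph_sym[of _ _ n]
  by (auto simp: paths_between_iff hd_rev last_rev elim: successively_mono)

text \<open>Reversing all paths of a family preserves its size, disjointness and vertex-properness,
  so \<open>u < v\<close> may be assumed.\<close>

lemma proper_vertex_connected_cycle_graphI:
  assumes "\<And>u v. u < v \<Longrightarrow> v < n \<Longrightarrow> \<exists>P \<subseteq> paths_between (cycle_graph n) u v.
      finite P \<and> card P = k \<and> disjoint_paths P \<and> (\<forall>p\<in>P. vertex_proper_path c p)"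
  shows "proper_vertex_connected k (cycle_graph n) c"
  unfolding proper_vertex_connected_def
proof (intro ballI impI)
  fix u v assume uv: "u \<in> pverts (cycle_graph n)" "v \<in> pverts (cycle_graph n)" "u \<noteq> v"
  show "\<exists>P \<subseteq> paths_between (cycle_graph n) u v.
      finite P \<and> card P = k \<and> disjoint_paths P \<and> (\<forall>p\<in>P. vertex_proper_path c p)"
  proof (cases "u < v")
    case True
    then show ?thesis using assms uv by simp
  next
    case False
    then have "v < u" "u < n" using uv by auto
    from assms[OF this] obtain P where P: "P \<subseteq> paths_between (cycle_graph n) v u"
      "finite P" "card P = k" "disjoint_paths P" "\<forall>p\<in>P. vertex_proper_path c p"
      by blast
    have "rev ` P \<subseteq> paths_between (cycle_graph n) u v"
      using P(1) rev_mem_paths_between_cycle_graph by blast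
    moreover have "card (rev ` P) = k"
      using P(3) by (simp add: card_image)
    moreover have "disjoint_paths (rev ` P)"
      using P(4) by (auto simp: disjoint_paths_def pairwise_def internal_rev)
    ultimately show ?thesis
      using P(2,5) by (intro exI[of _ "rev ` P"]) (auto simp: vertex_proper_path_rev)
  qed
qed

section \<open>The two arcs between two vertices\<close>

text \<open>"Short" means avoiding the edge between \<open>n - 1\<close> and \<open>0\<close>; this
  arc can be longer than \<open>long_arc\<close>, which descends from \<open>u\<close> to
  \<open>0\<close>, crosses that edge and descends from \<open>n - 1\<close> to
  \<open>v\<close>.\<close>

definition short_arc :: "nat \<Rightarrow> nat \<Rightarrow> nat list" where
  "short_arc u v = [u..<Suc v]"

definition long_arc :: "nat \<Rightarrow> nat \<Rightarrow> nat \<Rightarrow> nat list" where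
  "long_arc n u v = rev [0..<Suc u] @ rev [v..<n]"

lemma successively_upt: "(\<And>x. i \<le> x \<Longrightarrow> Suc x < j \<Longrightarrow> P x (Suc x)) \<Longrightarrow> successively P [i..<j]"
  by (simp add: successively_conv_nth)

lemma short_arc_mem_paths_between:
  "u < v \<Longrightarrow> v < n \<Longrightarrow> short_arc u v \<in> paths_between (cycle_graph n) u v"
  by (auto simp: paths_between_iff short_arc_def parcs_cycle_graph_iff
      simp del: upt_Suc intro!: successively_upt)

lemma long_arc_mem_paths_between:
  "u < v \<Longrightarrow> v < n \<Longrightarrow> long_arc n u v \<in> paths_between (cycle_graph n) u v"
  by (auto simp: paths_between_iff long_arc_def parcs_cycle_graph_iff successively_append_iff
      hd_rev last_rev hd_append last_append simp del: upt_Suc intro!: successively_upt)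

lemma internal_short_arc: "u < v \<Longrightarrow> internal (short_arc u v) = [Suc u..<v]"
  by (simp add: internal_def short_arc_def upt_rec[of u])

lemma internal_long_arc:
  "v < n \<Longrightarrow> internal (long_arc n u v) = rev [0..<u] @ rev [Suc v..<n]"
  by (simp add: internal_def long_arc_def upt_rec[of v] butlast_append)

lemma proper_vertex_connected_1_cycle_graphI:
  assumes "\<And>u v. u < v \<Longrightarrow> v < n \<Longrightarrow>
    vertex_proper_path c (short_arc u v) \<or> vertex_proper_path c (long_arc n u v)"
  shows "proper_vertex_connected 1 (cycle_graph n) c"
proof (rule proper_vertex_connected_cycle_graphI)
  fix u v assume uv: "u < v" "v < n"
  from assms[OF uv] obtain p
    where "p \<in> paths_between (cycle_graph n) u v" "vertex_proper_path c p"
    using short_arc_mem_paths_between[OF uv] long_arc_mem_paths_between[OF uv] by blast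
  then show "\<exists>P \<subseteq> paths_between (cycle_graph n) u v.
      finite P \<and> card P = 1 \<and> disjoint_paths P \<and> (\<forall>p\<in>P. vertex_proper_path c p)"
    by (intro exI[of _ "{p}"]) (simp add: disjoint_paths_def)
qed

lemma proper_vertex_connected_2_cycle_graphI:
  assumes "n \<ge> 3"
    and "\<And>u v. u < v \<Longrightarrow> v < n \<Longrightarrow>
      vertex_proper_path c (short_arc u v) \<and> vertex_proper_path c (long_arc n u v)"
  shows "proper_vertex_connected 2 (cycle_graph n) c"
proof (rule proper_vertex_connected_cycle_graphI)
  fix u v assume uv: "u < v" "v < n"
  \<comment> \<open>The interiors are disjoint, so if equal they are both empty. This forces
    \<open>u = 0\<close>, \<open>v = 1\<close> and \<open>n = 2\<close>.\<close>
  have "internal (short_arc u v) \<noteq> internal (long_arc n u v)"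
  proof
    assume eq: "internal (short_arc u v) = internal (long_arc n u v)"
    have "set (internal (short_arc u v)) \<inter> set (internal (long_arc n u v)) = {}"
      using uv by (auto simp: internal_short_arc internal_long_arc)
    then have "internal (short_arc u v) = []" "internal (long_arc n u v) = []"
      using eq by auto
    then show False
      using uv \<open>n \<ge> 3\<close> by (simp add: internal_short_arc internal_long_arc)
  qed
  then have "short_arc u v \<noteq> long_arc n u v" by auto
  moreover have "disjoint_paths {short_arc u v, long_arc n u v}"
    using uv by (auto simp: disjoint_paths_def pairwise_def internal_short_arc internal_long_arc)
  ultimately show "\<exists>P \<subseteq> paths_between (cycle_graph n) u v.
      finite P \<and> card P = 2 \<and> disjoint_paths P \<and> (\<forall>p\<in>P. vertex_proper_path c p)"
    using assms(2)[OF uv] short_arc_mem_paths_between[OF uv] long_arc_mem_paths_between[OF uv]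
    by (intro exI[of _ "{short_arc u v, long_arc n u v}"]) simp
qed

section \<open>Colorings that suffice\<close>

lemma successively_butlast: "successively P xs \<Longrightarrow> successively P (butlast xs)"
  by (cases xs rule: rev_cases) (auto simp: successively_append_iff)

lemma successively_internal: "successively P p \<Longrightarrow> successively P (internal p)"
  by (cases p) (auto simp: internal_def successively_Cons intro: successively_butlast)

lemma set_internal_subset: "set (internal p) \<subseteq> set p"
  by (cases p) (auto simp: internal_def dest: in_set_butlastD)

text \<open>Consecutive vertices of a path are adjacent, hence differ in color, and this passes to
  the contiguous sublist of internal vertices.\<close>

lemma vertex_proper_path_if_properly_colored:
  assumes "p \<in> paths_between G u v"
    and "\<And>x. x \<in> pverts G \<Longrightarrow> c x \<noteq> None"
    and "\<And>x y. (x, y) \<in> parcs G \<Longrightarrow> c x \<noteq> c y"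
  shows "vertex_proper_path c p"
proof -
  have "successively (\<lambda>x y. c x \<noteq> c y) p"
    using assms(1,3) by (auto simp: paths_between_iff elim: successively_mono)
  then show ?thesis
    using assms(1,2) set_internal_subset[of p]
    by (auto simp: vertex_proper_path_def paths_between_iff intro!: successively_internal)
qed

lemma proper_vertex_connected_2_if_properly_colored:
  assumes "n \<ge> 3"
    and "\<And>x. x < n \<Longrightarrow> c x \<noteq> None"
    and "\<And>x y. (x, y) \<in> parcs (cycle_graph n) \<Longrightarrow> c x \<noteq> c y"
  shows "proper_vertex_connected 2 (cycle_graph n) c"
proof (rule proper_vertex_connected_2_cycle_graphI)
  fix u v assume uv: "u < v" "v < n"
  show "vertex_proper_path c (short_arc u v) \<and> vertex_proper_path c (long_arc n u v)"
  proof
    show "vertex_proper_path c (short_arc u v)"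
      by (rule vertex_proper_path_if_properly_colored[OF short_arc_mem_paths_between[OF uv]])
        (use assms in auto)
    show "vertex_proper_path c (long_arc n u v)"
      by (rule vertex_proper_path_if_properly_colored[OF long_arc_mem_paths_between[OF uv]])
        (use assms in auto)
  qed
qed (rule assms)

lemma proper_vertex_connected_1_parity:
  "proper_vertex_connected 1 (cycle_graph n) (\<lambda>v. Some (v mod 2))"
proof (rule proper_vertex_connected_1_cycle_graphI)
  fix u v assume "u < v" "v < n"
  have "successively (\<lambda>x y. x mod 2 \<noteq> y mod 2) [Suc u..<v]"
    by (rule successively_upt) presburger
  with \<open>u < v\<close> show "vertex_proper_path (\<lambda>v. Some (v mod 2)) (short_arc u v) \<or>
    vertex_proper_path (\<lambda>v. Some (v mod 2)) (long_arc n u v)"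
    by (simp add: vertex_proper_path_def internal_short_arc)
qed

lemma monochromatic_vertex_proper_path:
  "length (internal p) \<le> 1 \<Longrightarrow> vertex_proper_path (\<lambda>_. Some i) p"
  by (cases "internal p") (simp_all add: vertex_proper_path_def)

text \<open>The two arcs have \<open>n - 2 \<le> 3\<close> internal vertices in total, so one of
  them has at most one.\<close>

lemma proper_vertex_connected_1_monochromatic:
  assumes "n \<le> 5"
  shows "proper_vertex_connected 1 (cycle_graph n) (\<lambda>_. Some 0)"
proof (rule proper_vertex_connected_1_cycle_graphI)
  fix u v assume uv: "u < v" "v < n"
  then have "length (internal (short_arc u v)) \<le> 1 \<or> length (internal (long_arc n u v)) \<le> 1"
    using assms by (simp add: internal_short_arc internal_long_arc) arith
  then show "vertex_proper_path (\<lambda>_. Some 0) (short_arc u v) \<or>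
    vertex_proper_path (\<lambda>_. Some 0) (long_arc n u v)"
    by (metis monochromatic_vertex_proper_path)
qed

text \<open>In the triangle the two arcs share a total of one internal vertex, so neither has more
  than one.\<close>

lemma proper_vertex_connected_2_triangle:
  "proper_vertex_connected 2 (cycle_graph 3) (\<lambda>_. Some 0)"
proof (rule proper_vertex_connected_2_cycle_graphI)
  fix u v :: nat assume uv: "u < v" "v < 3"
  then have "length (internal (short_arc u v)) \<le> 1 \<and> length (internal (long_arc 3 u v)) \<le> 1"
    by (simp add: internal_short_arc internal_long_arc) arith
  then show "vertex_proper_path (\<lambda>_. Some 0) (short_arc u v) \<and>
    vertex_proper_path (\<lambda>_. Some 0) (long_arc 3 u v)"
    by (metis monochromatic_vertex_proper_path)
qed simp

text \<open>With one internal vertex in total, one of the arcs is a bare edge.\<close>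

lemma proper_vertex_connected_1_triangle_uncolored:
  "proper_vertex_connected 1 (cycle_graph 3) (\<lambda>_. None)"
proof (rule proper_vertex_connected_1_cycle_graphI)
  fix u v :: nat assume uv: "u < v" "v < 3"
  then have "internal (short_arc u v) = [] \<or> internal (long_arc 3 u v) = []"
    by (simp add: internal_short_arc internal_long_arc) arith
  then show "vertex_proper_path (\<lambda>_. None) (short_arc u v) \<or>
    vertex_proper_path (\<lambda>_. None) (long_arc 3 u v)"
    by (auto simp: vertex_proper_path_def)
qed

section \<open>Paths supplied by connectivity and bounds on their length\<close>

lemma proper_vertex_connectedD:
  assumes "proper_vertex_connected k G c" "u \<in> pverts G" "v \<in> pverts G" "u \<noteq> v"
  obtains P where "finite P" "card P = k"
    "\<And>p. p \<in> P \<Longrightarrow> p \<in> paths_between G u v \<and> vertex_proper_path c p"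
  using assms unfolding proper_vertex_connected_def by (metis subsetD)

lemma proper_vertex_connected_1D:
  assumes "proper_vertex_connected 1 G c" "u \<in> pverts G" "v \<in> pverts G" "u \<noteq> v"
  obtains p where "p \<in> paths_between G u v" "vertex_proper_path c p"
  using proper_vertex_connectedD[OF assms] by (metis card_1_singletonE insertI1)

text \<open>Two distinct paths cannot both equal \<open>q\<close>. Taking the edge itself for
  \<open>q\<close> yields a path that makes a detour.\<close>

lemma proper_vertex_connected_2D:
  assumes "proper_vertex_connected 2 G c" "u \<in> pverts G" "v \<in> pverts G" "u \<noteq> v"
  obtains p where "p \<in> paths_between G u v" "vertex_proper_path c p" "p \<noteq> q"
proof -
  obtain P where P: "finite P" "card P = 2"
    "\<And>p. p \<in> P \<Longrightarrow> p \<in> paths_between G u v \<and> vertex_proper_path c p"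
    using proper_vertex_connectedD[OF assms] by blast
  then have "\<not> P \<subseteq> {q}"
    using card_mono[of "{q}" P] by auto
  then show thesis using P(3) that by blast
qed

lemma length_monochromatic_vertex_proper_path_le:
  assumes "vertex_proper_path c p" "set p \<subseteq> V" "\<And>x y. x \<in> V \<Longrightarrow> y \<in> V \<Longrightarrow> c x = c y"
  shows "length p \<le> 3"
proof (rule ccontr)
  assume "\<not> length p \<le> 3"
  then have "Suc (Suc (Suc (Suc 0))) \<le> length p" by simp
  \<comment> \<open>Both \<open>x\<close> and \<open>y\<close> are internal, since \<open>a\<close>
    precedes them and \<open>b\<close> follows.\<close>
  then obtain a x y b r where p: "p = a # x # y # b # r"
    by (metis Suc_le_length_iff)
  then have "c x \<noteq> c y"
    using assms(1) by (auto simp: vertex_proper_path_def internal_def)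
  then show False using assms(2,3) p by auto
qed

lemma length_le_3_cases:
  assumes "length p \<le> 3" "p \<in> paths_between G u v" "u \<noteq> v"
  obtains "p = [u, v]" "(u, v) \<in> parcs G"
    | x where "p = [u, x, v]" "(u, x) \<in> parcs G" "(x, v) \<in> parcs G"
proof -
  have "length p = 0 \<or> length p = 1 \<or> length p = 2 \<or> length p = 3"
    using assms(1) by arith
  then show thesis
    using assms(2,3) that
    by (auto simp: numeral_eq_Suc length_Suc_conv paths_between_iff)
qed

section \<open>Counting colors\<close>

lemma pvc_k_eqI:
  assumes "vertex_coloring G c" "num_colors G c = m" "proper_vertex_connected k G c"
    and "\<And>c. vertex_coloring G c \<Longrightarrow> proper_vertex_connected k G c \<Longrightarrow> m \<le> num_colors G c"
  shows "pvc_k k G = m"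
  unfolding pvc_k_def using assms by (intro Least_equality) blast+

lemma num_colors_uncolored: "num_colors G (\<lambda>_. None) = 0"
  by (simp add: num_colors_def)

lemma num_colors_monochromatic:
  assumes "pverts G \<noteq> {}"
  shows "num_colors G (\<lambda>_. Some i) = 1"
proof -
  have "{j. \<exists>v\<in>pverts G. Some i = Some j} = {i}"
    using assms by auto
  then show ?thesis by (simp add: num_colors_def)
qed

lemma num_colors_parity:
  assumes "n \<ge> 2"
  shows "num_colors (cycle_graph n) (\<lambda>v. Some (v mod 2)) = 2"
proof -
  have "{i. \<exists>v\<in>{..<n}. v mod 2 = i} = {0, 1}"
    using assms by (auto intro: bexI[of _ 0] bexI[of _ 1])
  then show ?thesis by (simp add: num_colors_def)
qed

lemma num_colors_parity_last:
  assumes "n \<ge> 3"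
  shows "num_colors (cycle_graph n) (\<lambda>v. Some (if v = n - 1 then 2 else v mod 2)) = 3"
proof -
  have "{i. \<exists>v\<in>{..<n}. (if v = n - 1 then 2 else v mod 2) = i} = {0, 1, 2}"
    using assms
    by (auto intro: bexI[of _ 0] bexI[of _ 1] bexI[of _ "n - 1"])
  then show ?thesis by (simp add: num_colors_def)
qed

lemma card_le_num_colors:
  assumes "finite (pverts G)" "\<And>i. i \<in> S \<Longrightarrow> \<exists>v\<in>pverts G. c v = Some i"
  shows "card S \<le> num_colors G c"
  unfolding num_colors_def
proof (rule card_mono)
  \<comment> \<open>Finiteness has to be shown because \<open>card\<close> of an infinite set is
    0.\<close>
  have "{i. \<exists>v\<in>pverts G. c v = Some i} \<subseteq> (\<lambda>v. the (c v)) ` pverts G"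
    by force
  then show "finite {i. \<exists>v\<in>pverts G. c v = Some i}"
    using assms(1) finite_surj by blast
qed (use assms(2) in auto)

lemma uncolored_if_num_colors_eq_0:
  assumes "num_colors G c = 0" "finite (pverts G)" "v \<in> pverts G"
  shows "c v = None"
  using card_le_num_colors[of G "{the (c v)}" c] assms by force

text \<open>Two different values cannot both be \<open>None\<close>, which rules out the uncolored
  alternative of \<open>vertex_coloring\<close>.\<close>

lemma vertex_coloring_SomeE:
  assumes "vertex_coloring G c" "c x \<noteq> c y" "x \<in> pverts G" "y \<in> pverts G" "v \<in> pverts G"
  obtains i where "c v = Some i"
  using assms by (auto simp: vertex_coloring_def)

lemma num_colors_ge_2:
  assumes "vertex_coloring G c" "finite (pverts G)" "c x \<noteq> c y" "x \<in> pverts G" "y \<in> pverts G"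
  shows "2 \<le> num_colors G c"
proof -
  obtain i j where ij: "c x = Some i" "c y = Some j"
    using vertex_coloring_SomeE assms by metis
  then have "card {i, j} \<le> num_colors G c"
    using assms by (intro card_le_num_colors) auto
  then show ?thesis using ij assms(3) by auto
qed

lemma num_colors_ge_3:
  assumes "vertex_coloring G c" "finite (pverts G)" "x \<in> pverts G" "y \<in> pverts G" "z \<in> pverts G"
    and "c x \<noteq> c y" "c y \<noteq> c z" "c x \<noteq> c z"
  shows "3 \<le> num_colors G c"
proof -
  obtain i j k where ijk: "c x = Some i" "c y = Some j" "c z = Some k"
    using vertex_coloring_SomeE assms by metis
  then have "card {i, j, k} \<le> num_colors G c"
    using assms by (intro card_le_num_colors) auto
  then show ?thesis using ijk assms(6-8) by auto
qed

section \<open>Lower bounds of one and two colors\<close>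

text \<open>For \<open>n \<ge> 6\<close> the vertices \<open>0\<close> and \<open>3\<close> are at
  distance 3, so every path between them has at least two internal vertices.\<close>

lemma num_colors_ge_2_cycle_graph:
  assumes "n \<ge> 6" "vertex_coloring (cycle_graph n) c" "proper_vertex_connected 1 (cycle_graph n) c"
  shows "2 \<le> num_colors (cycle_graph n) c"
proof (rule ccontr)
  assume "\<not> 2 \<le> num_colors (cycle_graph n) c"
  \<comment> \<open>This covers the uncolored case as well, where both sides are
    \<open>None\<close>.\<close>
  then have mono: "c x = c y" if "x < n" "y < n" for x y
    using num_colors_ge_2[OF assms(2), of x y] that by auto
  obtain p where p: "p \<in> paths_between (cycle_graph n) 0 3" "vertex_proper_path c p"
    using assms(1) proper_vertex_connected_1D[OF assms(3), of 0 3] by auto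
  have "set p \<subseteq> {..<n}"
    using p(1) by (simp add: paths_between_iff)
  then have "length p \<le> 3"
    by (rule length_monochromatic_vertex_proper_path_le[OF p(2)]) (use mono in blast)
  then show False
    by (rule length_le_3_cases[OF _ p(1)])
      (use assms(1) in \<open>auto simp: parcs_cycle_graph_iff\<close>)
qed

lemma length_uncolored_vertex_proper_path_le:
  assumes "vertex_proper_path c p" "set p \<subseteq> V" "\<And>x. x \<in> V \<Longrightarrow> c x = None"
  shows "length p \<le> 2"
proof -
  have "internal p = []"
    using assms set_internal_subset[of p] unfolding vertex_proper_path_def
    by (metis list.set_intros(1) neq_Nil_conv subsetD)
  then have "length (internal p) = 0" by simp
  then show ?thesis unfolding internal_def by simp
qed

text \<open>For \<open>n \<ge> 4\<close> the vertices \<open>0\<close> and \<open>2\<close> are not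
  adjacent, so a path between them has an internal vertex, which must be colored.\<close>

lemma num_colors_ge_1_cycle_graph:
  assumes "n \<ge> 4" "proper_vertex_connected 1 (cycle_graph n) c"
  shows "1 \<le> num_colors (cycle_graph n) c"
proof (rule ccontr)
  assume "\<not> 1 \<le> num_colors (cycle_graph n) c"
  then have none: "c x = None" if "x < n" for x
    using uncolored_if_num_colors_eq_0[of "cycle_graph n" c x] that by auto
  obtain p where p: "p \<in> paths_between (cycle_graph n) 0 2" "vertex_proper_path c p"
    using assms(1) proper_vertex_connected_1D[OF assms(2), of 0 2] by auto
  have "set p \<subseteq> {..<n}"
    using p(1) by (simp add: paths_between_iff)
  then have len: "length p \<le> 2"
    by (rule length_uncolored_vertex_proper_path_le[OF p(2)]) (simp add: none)
  then have "length p \<le> 3" by simp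
  then show False
    by (rule length_le_3_cases[OF _ p(1)])
      (use assms(1) len in \<open>auto simp: parcs_cycle_graph_iff\<close>)
qed

text \<open>Of two paths from \<open>0\<close> to \<open>1\<close>, one is not the edge and
  therefore has an internal vertex.\<close>

lemma num_colors_ge_1_triangle:
  assumes "proper_vertex_connected 2 (cycle_graph 3) c"
  shows "1 \<le> num_colors (cycle_graph 3) c"
proof (rule ccontr)
  assume "\<not> 1 \<le> num_colors (cycle_graph 3) c"
  then have none: "c x = None" if "x < 3" for x
    using uncolored_if_num_colors_eq_0[of "cycle_graph 3" c x] that by auto
  obtain p where p: "p \<in> paths_between (cycle_graph 3) 0 1" "vertex_proper_path c p" "p \<noteq> [0, 1]"
    using proper_vertex_connected_2D[OF assms, of 0 1] by auto
  have "set p \<subseteq> {..<3}"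
    using p(1) by (simp add: paths_between_iff)
  then have len: "length p \<le> 2"
    by (rule length_uncolored_vertex_proper_path_le[OF p(2)]) (simp add: none)
  then have "length p \<le> 3" by simp
  then show False
    by (rule length_le_3_cases[OF _ p(1)]) (use p(3) len in auto)
qed

section \<open>Two disjoint paths force a proper coloring; odd cycles\<close>

lemma Suc_mod_inj: "Suc i mod n = Suc j mod n \<Longrightarrow> i < n \<Longrightarrow> j < n \<Longrightarrow> i = j"
  by (auto simp: mod_Suc split: if_splits)

text \<open>The vertices \<open>i\<close>, \<open>j\<close>, \<open>u\<close>, \<open>v\<close>
  follow each other along the cycle. A detour from \<open>u\<close> to \<open>v\<close> has
  \<open>j\<close> and \<open>i\<close> as adjacent internal vertices, so their colors
  differ.\<close>

lemma properly_colored_if_proper_vertex_connected_2_aux: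
  assumes "n \<ge> 4" "proper_vertex_connected 2 (cycle_graph n) c" "i < n"
  shows "c i \<noteq> c (Suc i mod n)"
proof -
  define j where "j = Suc i mod n"
  define u where "u = Suc j mod n"
  define v where "v = Suc u mod n"
  have lt: "j < n" "u < n" "v < n"
    using assms(1) by (auto simp: j_def u_def v_def)
  \<comment> \<open>Here \<open>v\<close> is \<open>i + 3\<close> modulo \<open>n\<close>, so
    \<open>i \<noteq> v\<close> relies on \<open>n \<ge> 4\<close>.\<close>
  have ne: "u \<noteq> v" "i \<noteq> v"
    using assms(1,3) by (auto simp: j_def u_def v_def mod_Suc split: if_splits)
  text \<open>
    Besides the edge itself, the only path from \<open>u = i + 2\<close> to \<open>v = i + 3\<close> starts \<open>u, j, i\<close> and does
    not end at \<open>i\<close>.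
  \<close>
  obtain p where p: "p \<in> paths_between (cycle_graph n) u v" "vertex_proper_path c p" "p \<noteq> [u, v]"
    using proper_vertex_connected_2D[OF assms(2), of u v] lt ne by auto
  from p(1) ne(1) obtain x r where pr: "p = u # x # r"
    unfolding paths_between_iff by (metis last.simps list.exhaust_sel)
  \<comment> \<open>If \<open>x = v\<close>, distinctness and \<open>last p = v\<close> leave only
    \<open>p = [u, v]\<close>.\<close>
  have "x \<noteq> v"
    using p(1,3) pr by (cases r) (auto simp: paths_between_iff dest: last_in_set split: if_splits)
  moreover have "(u, x) \<in> parcs (cycle_graph n)"
    using p(1) pr by (simp add: paths_between_iff)
  ultimately have x: "x = j"
    using Suc_mod_inj[of j n x] lt by (auto simp: parcs_cycle_graph_mod_iff u_def v_def)
  then obtain y r' where r: "r = y # r'"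
    using p(1) \<open>x \<noteq> v\<close> pr by (cases r) (auto simp: paths_between_iff)
  have "y \<noteq> u" "(j, y) \<in> parcs (cycle_graph n)"
    using p(1) pr r x by (auto simp: paths_between_iff)
  then have y: "y = i"
    using Suc_mod_inj[of i n y] assms(3) by (auto simp: parcs_cycle_graph_mod_iff j_def u_def)
  then have "r' \<noteq> []"
    using p(1) pr r ne(2) by (auto simp: paths_between_iff)
  then have "internal p = j # i # butlast r'"
    using pr r x y by (simp add: internal_def)
  then show ?thesis
    using p(2) by (auto simp: vertex_proper_path_def j_def)
qed

lemma properly_colored_if_proper_vertex_connected_2:
  assumes "n \<ge> 4" "proper_vertex_connected 2 (cycle_graph n) c" "(i, j) \<in> parcs (cycle_graph n)"
  shows "c i \<noteq> c j"
proof -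
  note aux = properly_colored_if_proper_vertex_connected_2_aux[OF assms(1,2)]
  from assms(3) consider "i < n" "j = Suc i mod n" | "j < n" "i = Suc j mod n"
    unfolding parcs_cycle_graph_mod_iff by blast
  then show ?thesis
  proof cases
    case 1
    then show ?thesis using aux[of i] by blast
  next
    case 2
    then show ?thesis using aux[of j] by metis
  qed
qed

text \<open>With fewer than three colors, vertices two steps apart agree, so all even vertices have
  the color of \<open>0\<close>. For odd \<open>n\<close> these include \<open>n - 1\<close>, a
  neighbor of \<open>0\<close>.\<close>

lemma num_colors_ge_3_properly_colored_odd_cycle:
  assumes "odd n" "n \<ge> 3" "vertex_coloring (cycle_graph n) c"
    and proper: "\<And>i j. (i, j) \<in> parcs (cycle_graph n) \<Longrightarrow> c i \<noteq> c j"
  shows "3 \<le> num_colors (cycle_graph n) c"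
proof (rule ccontr)
  assume less: "\<not> 3 \<le> num_colors (cycle_graph n) c"
  have step: "c (Suc (Suc i)) = c i" if "Suc (Suc i) < n" for i
  proof (rule ccontr)
    assume "c (Suc (Suc i)) \<noteq> c i"
    moreover have "c i \<noteq> c (Suc i)" "c (Suc i) \<noteq> c (Suc (Suc i))"
      using that by (auto intro!: proper simp: parcs_cycle_graph_iff)
    ultimately have "3 \<le> num_colors (cycle_graph n) c"
      using that by (intro num_colors_ge_3[OF assms(3), of i "Suc i" "Suc (Suc i)"]) simp_all
    then show False using less by contradiction
  qed
  have "c (2 * k) = c 0" if "2 * k < n" for k
    using that
  proof (induction k)
    case (Suc k)
    then show ?case using step[of "2 * k"] by simp
  qed simp
  \<comment> \<open>For odd \<open>n\<close>, \<open>2 * (n div 2) = n - 1\<close>.\<close>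
  from this[of "n div 2"] have "c (n - 1) = c 0"
    using assms(1) by (simp add: odd_two_times_div_two_nat odd_pos)
  moreover have "c (n - 1) \<noteq> c 0"
    using assms(2) by (intro proper) (simp add: parcs_cycle_graph_iff)
  ultimately show False by simp
qed

section \<open>The values for each cycle\<close>

lemma pvc_cycle_graph_3: "pvc (cycle_graph 3) = 0"
  using proper_vertex_connected_1_triangle_uncolored
  by (intro pvc_k_eqI[where c = "\<lambda>_. None"]) (auto simp: vertex_coloring_def num_colors_uncolored)

lemma pvc_cycle_graph_4_5:
  assumes "4 \<le> n" "n \<le> 5"
  shows "pvc (cycle_graph n) = 1"
  using assms num_colors_ge_1_cycle_graph proper_vertex_connected_1_monochromatic
  by (intro pvc_k_eqI[where c = "\<lambda>_. Some 0"] num_colors_monochromatic)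
    (auto simp: vertex_coloring_def lessThan_empty_iff)

lemma pvc_cycle_graph_ge_6:
  assumes "n \<ge> 6"
  shows "pvc (cycle_graph n) = 2"
  using assms num_colors_ge_2_cycle_graph proper_vertex_connected_1_parity num_colors_parity
  by (intro pvc_k_eqI[where c = "\<lambda>v. Some (v mod 2)"]) (auto simp: vertex_coloring_def)

lemma pvc_2_cycle_graph_3: "pvc_k 2 (cycle_graph 3) = 1"
  using num_colors_ge_1_triangle proper_vertex_connected_2_triangle
  by (intro pvc_k_eqI[where c = "\<lambda>_. Some 0"] num_colors_monochromatic)
    (auto simp: vertex_coloring_def lessThan_empty_iff)

lemma pvc_2_cycle_graph_even:
  assumes "n \<ge> 4" "even n"
  shows "pvc_k 2 (cycle_graph n) = 2"
proof (rule pvc_k_eqI[where c = "\<lambda>v. Some (v mod 2)"])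
  show "proper_vertex_connected 2 (cycle_graph n) (\<lambda>v. Some (v mod 2))"
  proof (rule proper_vertex_connected_2_if_properly_colored)
    \<comment> \<open>Parity also separates the ends of the wraparound edge, because
      \<open>n - 1\<close> is odd.\<close>
    show "Some (x mod 2) \<noteq> Some (y mod 2)" if "(x, y) \<in> parcs (cycle_graph n)" for x y
      using that assms by (auto simp: parcs_cycle_graph_iff mod_Suc mod2_eq_if)
  qed (use assms in auto)
next
  fix c assume c: "vertex_coloring (cycle_graph n) c" "proper_vertex_connected 2 (cycle_graph n) c"
  have "c 0 \<noteq> c 1"
    using assms(1) by (intro properly_colored_if_proper_vertex_connected_2[OF _ c(2)])
      (auto simp: parcs_cycle_graph_iff)
  then show "2 \<le> num_colors (cycle_graph n) c"
    using assms(1) by (intro num_colors_ge_2[OF c(1)]) auto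
qed (use assms num_colors_parity in \<open>auto simp: vertex_coloring_def\<close>)

text \<open>For odd \<open>n\<close> parity would give \<open>n - 1\<close> the color of its
  neighbor \<open>0\<close>; a third color at \<open>n - 1\<close> removes this single
  conflict.\<close>

lemma pvc_2_cycle_graph_odd:
  assumes "n \<ge> 5" "odd n"
  shows "pvc_k 2 (cycle_graph n) = 3"
proof (rule pvc_k_eqI[where c = "\<lambda>v. Some (if v = n - 1 then 2 else v mod 2)"])
  show "proper_vertex_connected 2 (cycle_graph n) (\<lambda>v. Some (if v = n - 1 then 2 else v mod 2))"
  proof (rule proper_vertex_connected_2_if_properly_colored)
    show "Some (if x = n - 1 then 2 else x mod 2) \<noteq> Some (if y = n - 1 then 2 else y mod 2)"
      if "(x, y) \<in> parcs (cycle_graph n)" for x y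
      using that assms(1) by (auto simp: parcs_cycle_graph_iff mod_Suc split: if_splits)
  qed (use assms in auto)
next
  fix c assume c: "vertex_coloring (cycle_graph n) c" "proper_vertex_connected 2 (cycle_graph n) c"
  show "3 \<le> num_colors (cycle_graph n) c"
    using assms
    by (intro num_colors_ge_3_properly_colored_odd_cycle c(1)
        properly_colored_if_proper_vertex_connected_2[OF _ c(2)]) auto
qed (use assms num_colors_parity_last in \<open>auto simp: vertex_coloring_def\<close>)

theorem theorem2:
  shows "(pvc (cycle_graph 3) = 0 \<and>
          pvc (cycle_graph 4) = 1 \<and> pvc (cycle_graph 5) = 1 \<and>
          (\<forall>n\<ge>6. pvc (cycle_graph n) = 2)) \<and>
         (pvc_k 2 (cycle_graph 3) = 1 \<and>
          (\<forall>n\<ge>4. even n \<longrightarrow> pvc_k 2 (cycle_graph n) = 2) \<and>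
          (\<forall>n\<ge>5. odd n \<longrightarrow> pvc_k 2 (cycle_graph n) = 3))"
  using pvc_cycle_graph_3 pvc_cycle_graph_4_5 pvc_cycle_graph_ge_6
    pvc_2_cycle_graph_3 pvc_2_cycle_graph_even pvc_2_cycle_graph_odd
  by simp

end
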